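(* Let $\beta,\alpha$ be two non-negative increasing sequences that tend to infinity. Assume that $\beta$ is stable and that there exist $A,B>0$ such that $\beta_n\le A\alpha_n+B$ for all $n\in\mathbb{N}$. Then, for every $\theta=(\theta_n)_{n\in\mathbb{N}_0}\in\Lambda_1(\beta)$, the Hankel operator $H_\theta:\Lambda_\infty(\alpha)\to\Lambda_1(\beta)$ is well-defined, continuous and compact.
   Context: $\mathbb{N}=\{1,2,\dots\}$, $\mathbb{N}_0=\mathbb{N}\cup\{0\}$. For a non-negative increasing sequence $\alpha=(\alpha_n)_{n\in\mathbb{N}}$ with $\alpha_n\to\infty$, the power series space of finite type is the Fréchet space $\Lambda_1(\alpha)=\{x=(x_n)_{n\in\mathbb{N}}:\ \|x\|_k:=\sum_{n=1}^\infty|x_n|e^{-\frac1k\alpha_n}<\infty\ \text{for all }k\in\mathbb{N}\}$, and the power series space of infinite type is the Fréchet space $\Lambda_\infty(\alpha)=\{x=(x_n)_{n\in\mathbb{N}}:\ \|x\|_k:=\sum_{n=1}^\infty|x_n|e^{k\alpha_n}<\infty\ \text{for all }k\in\mathbb{N}\}$, each with the seminorms $\|\cdot\|_k$, $k\in\mathbb{N}$. A sequence $\beta$ is stable if $\sup_{n\in\mathbb{N}}\beta_{2n}/\beta_n<\infty$, i.e. there is $M$ with $\beta_{2n}\le M\beta_n$ for all $n$. The sequence $e_n$ has $1$ in the $n$-th place and $0$ elsewhere. A sequence $\theta=(\theta_n)_{n\in\mathbb{N}_0}$ is identified with the sequence $(\theta_{n-1})_{n\in\mathbb{N}}=(\theta_0,\theta_1,\theta_2,\dots)$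 when it is said to belong to a sequence space. The Hankel operator $H_\theta:E\to F$ between such sequence spaces is given by $H_\theta e_n=(\theta_{n-1},\theta_n,\theta_{n+1},\dots)=\sum_{j=1}^\infty\theta_{j+n-2}e_j$ for $n\in\mathbb{N}$ and $H_\theta x=\sum_{n=1}^\infty x_nH_\theta e_n$ for $x=(x_n)\in E$. It is well-defined if $H_\theta e_n\in F$ for all $n$ and the series $\sum_n x_nH_\theta e_n$ converges in $F$ for every $x\in E$. A linear map $T:E\to F$ between Fréchet spaces is compact if $T(U)$ is precompact in $F$ for some neighborhood $U$ of zero in $E$. *)

theory Defs
  imports "HOL-Analysis.Analysis"
begin

text \<open>
  A scalar sequence \<open>(x\<^sub>n)\<close> indexed by \<open>n \<ge> 1\<close> is a function on \<^typ>\<open>nat\<close>; members of a sequence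
  space are normalised to vanish at the unused index \<open>0\<close>, so that distinct functions are distinct
  sequences. The values \<open>\<alpha> 0\<close> and \<open>\<beta> 0\<close> of exponent sequences are never used.
  The seminorm index \<open>k\<close> also ranges over \<open>k \<ge> 1\<close> only.
  The scalar field is kept generic, so that the real and the complex numbers are covered at once:
  the type class constraints \<open>real_normed_field\<close>, \<open>banach\<close> and \<open>heine_borel\<close> hold for both.
\<close>

definition wnorm :: "(nat \<Rightarrow> nat \<Rightarrow> real) \<Rightarrow> nat \<Rightarrow> (nat \<Rightarrow> 'a::real_normed_field) \<Rightarrow> real" where
  "wnorm w k x = (\<Sum>\<^sub>\<infinity>n\<in>{1..}. norm (x n) * w k n)"

definition wspace :: "(nat \<Rightarrow> nat \<Rightarrow> real) \<Rightarrow> (nat \<Rightarrow> 'a::real_normed_field) set" where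
  "wspace w = {x. x 0 = 0 \<and> (\<forall>k\<ge>1. (\<lambda>n. norm (x n) * w k n) summable_on {1..})}"

text \<open>The locally convex topology given by the seminorms: all seminorm balls form a subbase.\<close>

definition wtop :: "(nat \<Rightarrow> nat \<Rightarrow> real) \<Rightarrow> (nat \<Rightarrow> 'a::real_normed_field) topology" where
  "wtop w = topology_generated_by
     {{y \<in> wspace w. wnorm w k (\<lambda>n. y n - x n) < \<epsilon>} | k x \<epsilon>. k \<ge> 1 \<and> x \<in> wspace w \<and> \<epsilon> > 0}"

lemma topspace_wtop:
  "topspace (wtop w) = (wspace w :: (nat \<Rightarrow> 'a::real_normed_field) set)"
proof
  show "topspace (wtop w) \<subseteq> (wspace w :: (nat \<Rightarrow> 'a) set)"
    unfolding wtop_def topology_generated_by_topspace by auto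
  show "(wspace w :: (nat \<Rightarrow> 'a) set) \<subseteq> topspace (wtop w)"
  proof
    fix x :: "nat \<Rightarrow> 'a" assume x: "x \<in> wspace w"
    then have "x \<in> {y \<in> wspace w. wnorm w 1 (\<lambda>n. y n - x n) < 1}"
      by (simp add: wnorm_def)
    moreover have "{y \<in> wspace w. wnorm w 1 (\<lambda>n. y n - x n) < 1} \<in>
        {{y \<in> wspace w. wnorm w k (\<lambda>n. y n - z n) < \<epsilon>} | k z \<epsilon>. k \<ge> 1 \<and> z \<in> wspace w \<and> \<epsilon> > 0}"
      using x by (intro CollectI exI[of _ "1::nat"] exI[of _ x] exI[of _ "1::real"]) auto
    ultimately show "x \<in> topspace (wtop w)"
      unfolding wtop_def topology_generated_by_topspace by blast
  qed
qed

abbreviation Lambda_1 :: "(nat \<Rightarrow> real) \<Rightarrow> (nat \<Rightarrow> 'a::real_normed_field) topology" where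
  "Lambda_1 \<alpha> \<equiv> wtop (\<lambda>k n. exp (- (1 / real k) * \<alpha> n))"

abbreviation Lambda_inf :: "(nat \<Rightarrow> real) \<Rightarrow> (nat \<Rightarrow> 'a::real_normed_field) topology" where
  "Lambda_inf \<alpha> \<equiv> wtop (\<lambda>k n. exp (real k * \<alpha> n))"

text \<open>Non-negative, (weakly) increasing and tending to infinity, for indices \<open>n \<ge> 1\<close>.\<close>

definition exponent_sequence :: "(nat \<Rightarrow> real) \<Rightarrow> bool" where
  "exponent_sequence \<alpha> \<longleftrightarrow>
     (\<forall>n\<ge>1. 0 \<le> \<alpha> n) \<and> mono_on {1..} \<alpha> \<and> filterlim \<alpha> at_top sequentially"

definition stable_sequence :: "(nat \<Rightarrow> real) \<Rightarrow> bool" where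
  "stable_sequence \<beta> \<longleftrightarrow> (\<exists>M. \<forall>n\<ge>1. \<beta> (2 * n) \<le> M * \<beta> n)"

text \<open>The identification of \<open>(\<theta>\<^sub>n)\<close>, \<open>n \<ge> 0\<close>, with \<open>(\<theta>\<^sub>n\<^sub>-\<^sub>1)\<close>, \<open>n \<ge> 1\<close>.\<close>

definition reindex :: "(nat \<Rightarrow> 'a::zero) \<Rightarrow> nat \<Rightarrow> 'a" where
  "reindex \<theta> = (\<lambda>n. if n = 0 then 0 else \<theta> (n - 1))"

text \<open>The sequence \<open>H\<^sub>\<theta> e\<^sub>n\<close>, for \<open>n \<ge> 1\<close>; truncated subtraction is harmless since \<open>j + n \<ge> 2\<close>.\<close>

definition hankel_col :: "(nat \<Rightarrow> 'a::zero) \<Rightarrow> nat \<Rightarrow> nat \<Rightarrow> 'a" where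
  "hankel_col \<theta> n = (\<lambda>j. if j = 0 then 0 else \<theta> (j + n - 2))"

definition hankel_sums_to ::
    "(nat \<Rightarrow> 'a::real_normed_field) topology \<Rightarrow> (nat \<Rightarrow> 'a) \<Rightarrow> (nat \<Rightarrow> 'a) \<Rightarrow> (nat \<Rightarrow> 'a) \<Rightarrow> bool" where
  "hankel_sums_to F \<theta> x y \<longleftrightarrow>
     limitin F (\<lambda>N j. \<Sum>n=1..N. x n * hankel_col \<theta> n j) y sequentially"

definition hankel_well_defined ::
    "(nat \<Rightarrow> 'a::real_normed_field) topology \<Rightarrow> (nat \<Rightarrow> 'a) topology \<Rightarrow> (nat \<Rightarrow> 'a) \<Rightarrow> bool" where
  "hankel_well_defined E F \<theta> \<longleftrightarrow>
     (\<forall>n\<ge>1. hankel_col \<theta> n \<in> topspace F) \<and>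
     (\<forall>x\<in>topspace E. \<exists>y. hankel_sums_to F \<theta> x y)"

definition hankel ::
    "(nat \<Rightarrow> 'a::real_normed_field) topology \<Rightarrow> (nat \<Rightarrow> 'a) \<Rightarrow> (nat \<Rightarrow> 'a) \<Rightarrow> nat \<Rightarrow> 'a" where
  "hankel F \<theta> x = (THE y. hankel_sums_to F \<theta> x y)"

definition zero_nbhd :: "(nat \<Rightarrow> 'a::real_normed_field) topology \<Rightarrow> (nat \<Rightarrow> 'a) set \<Rightarrow> bool" where
  "zero_nbhd X U \<longleftrightarrow> U \<subseteq> topspace X \<and> (\<exists>W. openin X W \<and> (\<lambda>_. 0) \<in> W \<and> W \<subseteq> U)"

text \<open>
  Precompact means totally bounded in the uniformity of the topological vector space; in a complete
  space this amounts to relatively compact.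
\<close>

definition precompact_in :: "(nat \<Rightarrow> 'a::real_normed_field) topology \<Rightarrow> (nat \<Rightarrow> 'a) set \<Rightarrow> bool" where
  "precompact_in X A \<longleftrightarrow> A \<subseteq> topspace X \<and>
     (\<forall>V. zero_nbhd X V \<longrightarrow>
        (\<exists>T. finite T \<and> T \<subseteq> topspace X \<and> A \<subseteq> (\<Union>t\<in>T. (\<lambda>v n. t n + v n) ` V)))"

definition linear_map_on ::
    "(nat \<Rightarrow> 'a::real_normed_field) set \<Rightarrow> ((nat \<Rightarrow> 'a) \<Rightarrow> nat \<Rightarrow> 'a) \<Rightarrow> bool" where
  "linear_map_on S T \<longleftrightarrow>
     (\<forall>x\<in>S. \<forall>y\<in>S. \<forall>a b. T (\<lambda>n. a * x n + b * y n) = (\<lambda>n. a * T x n + b * T y n))"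

definition compact_operator ::
    "(nat \<Rightarrow> 'a::real_normed_field) topology \<Rightarrow> (nat \<Rightarrow> 'a) topology \<Rightarrow>
     ((nat \<Rightarrow> 'a) \<Rightarrow> nat \<Rightarrow> 'a) \<Rightarrow> bool" where
  "compact_operator E F T \<longleftrightarrow>
     linear_map_on (topspace E) T \<and> (\<exists>U. zero_nbhd E U \<and> precompact_in F (T ` U))"

end

theory Submission
  imports Defs
begin

text \<open>
  Write \<open>H\<^sub>\<theta> e\<^sub>n\<close> in terms of \<open>m = j + n - 1\<close>, the position of \<open>\<theta>\<^bsub>j+n-2\<^esub>\<close> in the shifted sequence.
  Since \<open>m \<le> 2 max j n\<close>, stability gives \<open>\<beta>\<^sub>m \<le> M \<beta>\<^sub>j\<close> if \<open>n \<le> j\<close>, and otherwise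
  \<open>\<beta>\<^sub>m \<le> M \<beta>\<^sub>n \<le> M A \<alpha>\<^sub>n + M B\<close>. In the first case \<open>exp (- \<beta>\<^sub>j / k) \<le> exp (- \<beta>\<^sub>m / (k M))\<close>, in the
  second \<open>exp (- \<beta>\<^sub>j / k) \<le> 1 \<le> exp (M B) exp (M A \<alpha>\<^sub>n) exp (- \<beta>\<^sub>m)\<close>. Summing against \<open>\<theta>\<close> bounds the
  \<open>k\<close>-th seminorm of \<open>H\<^sub>\<theta> e\<^sub>n\<close> by \<open>C\<^sub>k exp (p \<alpha>\<^sub>n)\<close> with \<open>p\<close> independent of \<open>k\<close>. Hence \<open>H\<^sub>\<theta>\<close> is
  continuous and maps a single neighbourhood of zero to a bounded set, and bounded sets of the
  finite type space are precompact because \<open>\<beta>\<close> tends to infinity.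
\<close>

section \<open>Weighted l1 sequence spaces and their seminorms\<close>

text \<open>These are Koethe matrices, which cover both types of power series space. Monotonicity in
  \<open>k\<close> orders the seminorms, so that single balls form a base of the topology. Both
  conditions are confined to indices from 1 on, where the seminorms live.\<close>

locale koethe_weights =
  fixes w :: "nat \<Rightarrow> nat \<Rightarrow> real"
  assumes weight_pos: "\<lbrakk>1 \<le> k; 1 \<le> n\<rbrakk> \<Longrightarrow> 0 < w k n"
    and weight_mono: "\<lbrakk>1 \<le> k; k \<le> l; 1 \<le> n\<rbrakk> \<Longrightarrow> w k n \<le> w l n"
begin

lemma weight_nonneg: "\<lbrakk>1 \<le> k; 1 \<le> n\<rbrakk> \<Longrightarrow> 0 \<le> w k n"
  using weight_pos[of k n] by simp

lemma wspace_summable: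
  "\<lbrakk>x \<in> wspace w; 1 \<le> k\<rbrakk> \<Longrightarrow> (\<lambda>n. norm (x n) * w k n) summable_on {1..}"
  unfolding wspace_def by auto

lemma wspace_0: "x \<in> wspace w \<Longrightarrow> x 0 = 0"
  unfolding wspace_def by auto

lemma wspaceI:
  assumes "x 0 = 0" "\<And>k. 1 \<le> k \<Longrightarrow> (\<lambda>n. norm (x n) * w k n) summable_on {1..}"
  shows "x \<in> wspace w"
  using assms unfolding wspace_def by auto

lemma wnorm_nonneg: "1 \<le> k \<Longrightarrow> 0 \<le> wnorm w k x"
  unfolding wnorm_def by (intro infsum_nonneg mult_nonneg_nonneg) (auto simp: weight_nonneg)

lemma zero_in_wspace: "(\<lambda>_. 0) \<in> wspace w"
  by (auto intro!: wspaceI)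

lemma wnorm_zero [simp]: "wnorm w k (\<lambda>_. 0) = 0"
  unfolding wnorm_def by simp

lemma
  fixes x y :: "nat \<Rightarrow> 'a::real_normed_field"
  assumes x: "x \<in> wspace w" and y: "y \<in> wspace w"
  shows lincomb_in_wspace: "(\<lambda>n. a * x n + b * y n) \<in> wspace w"
    and wnorm_lincomb_le:
      "1 \<le> k \<Longrightarrow> wnorm w k (\<lambda>n. a * x n + b * y n) \<le> norm a * wnorm w k x + norm b * wnorm w k y"
proof -
  have le: "norm (a * x n + b * y n) * w k n
      \<le> norm a * (norm (x n) * w k n) + norm b * (norm (y n) * w k n)"
    if "1 \<le> k" "1 \<le> n" for k n
  proof -
    have "norm (a * x n + b * y n) \<le> norm a * norm (x n) + norm b * norm (y n)"
      using norm_triangle_ineq[of "a * x n" "b * y n"] by (simp add: norm_mult)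
    from mult_right_mono[OF this weight_nonneg[OF that]] show ?thesis
      by (simp add: algebra_simps)
  qed
  have sx: "(\<lambda>n. norm a * (norm (x n) * w k n)) summable_on {1..}"
    and sy: "(\<lambda>n. norm b * (norm (y n) * w k n)) summable_on {1..}" if "1 \<le> k" for k
    using wspace_summable[OF x that] wspace_summable[OF y that] by (auto intro: summable_on_cmult_right)
  have s: "(\<lambda>n. norm (a * x n + b * y n) * w k n) summable_on {1..}" if "1 \<le> k" for k
    by (rule summable_on_comparison_test[OF summable_on_add[OF sx[OF that] sy[OF that]]])
      (use le that weight_nonneg in auto)
  show "(\<lambda>n. a * x n + b * y n) \<in> wspace w"
    using s wspace_0[OF x] wspace_0[OF y] by (intro wspaceI) auto
  assume k: "1 \<le> k"
  have "wnorm w k (\<lambda>n. a * x n + b * y n)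
      \<le> (\<Sum>\<^sub>\<infinity>n\<in>{1..}. norm a * (norm (x n) * w k n) + norm b * (norm (y n) * w k n))"
    unfolding wnorm_def
    by (rule infsum_mono[OF s[OF k] summable_on_add[OF sx[OF k] sy[OF k]]]) (use le k in auto)
  also have "\<dots> = norm a * wnorm w k x + norm b * wnorm w k y"
    unfolding wnorm_def infsum_add[OF sx[OF k] sy[OF k]] infsum_cmult_right' ..
  finally show "wnorm w k (\<lambda>n. a * x n + b * y n) \<le> norm a * wnorm w k x + norm b * wnorm w k y" .
qed

lemma diff_in_wspace: "\<lbrakk>x \<in> wspace w; y \<in> wspace w\<rbrakk> \<Longrightarrow> (\<lambda>n. x n - y n) \<in> wspace w"
  using lincomb_in_wspace[of x y 1 "-1"] by simp

lemma wnorm_add_le: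
  "\<lbrakk>x \<in> wspace w; y \<in> wspace w; 1 \<le> k\<rbrakk> \<Longrightarrow> wnorm w k (\<lambda>n. x n + y n) \<le> wnorm w k x + wnorm w k y"
  using wnorm_lincomb_le[of x y k 1 1] by simp

lemma wnorm_diff_triangle:
  assumes "x \<in> wspace w" "y \<in> wspace w" "z \<in> wspace w" "1 \<le> k"
  shows "wnorm w k (\<lambda>n. x n - z n) \<le> wnorm w k (\<lambda>n. x n - y n) + wnorm w k (\<lambda>n. y n - z n)"
  using wnorm_add_le[OF diff_in_wspace[OF assms(1,2)] diff_in_wspace[OF assms(2,3)] assms(4)] by simp

lemma wnorm_mono:
  assumes "x \<in> wspace w" "1 \<le> k" "k \<le> l"
  shows "wnorm w k x \<le> wnorm w l x"
  unfolding wnorm_def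
proof (rule infsum_mono)
  show "(\<lambda>n. norm (x n) * w k n) summable_on {1..}" "(\<lambda>n. norm (x n) * w l n) summable_on {1..}"
    using assms by (auto intro: wspace_summable simp del: One_nat_def)
qed (use assms weight_mono in \<open>auto intro: mult_left_mono\<close>)

lemma coordinate_le_wnorm:
  assumes "x \<in> wspace w" "1 \<le> k" "1 \<le> n"
  shows "norm (x n) * w k n \<le> wnorm w k x"
  unfolding wnorm_def
  using finite_sum_le_infsum[OF wspace_summable[OF assms(1,2)], of "{n}"] assms weight_nonneg by auto

section \<open>Open sets, limits and neighbourhoods of zero\<close>

definition wball :: "nat \<Rightarrow> (nat \<Rightarrow> 'a::real_normed_field) \<Rightarrow> real \<Rightarrow> (nat \<Rightarrow> 'a) set" where
  "wball k x e = {y \<in> wspace w. wnorm w k (\<lambda>n. y n - x n) < e}"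

lemma openin_wball: "\<lbrakk>1 \<le> k; x \<in> wspace w; 0 < e\<rbrakk> \<Longrightarrow> openin (wtop w) (wball k x e)"
  unfolding wtop_def wball_def by (rule topology_generated_by_Basis) auto

text \<open>The balls are given only as a subbase. They form a base because increasing seminorms let
  one ball fit into the intersection of two with the same centre, and the triangle inequality lets a
  ball be recentred at any of its points.\<close>

lemma openin_wtop_imp_wball:
  fixes U :: "(nat \<Rightarrow> 'a::real_normed_field) set"
  assumes "openin (wtop w) U" "x \<in> U"
  obtains k e where "1 \<le> k" "0 < e" "wball k x e \<subseteq> U"
proof -
  let ?B = "{{y \<in> wspace w. wnorm w k (\<lambda>n. y n - x n) < \<epsilon>} | k (x :: nat \<Rightarrow> 'a) \<epsilon>.
    k \<ge> 1 \<and> x \<in> wspace w \<and> \<epsilon> > 0}"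
  have "generate_topology_on ?B U"
    using assms(1) unfolding wtop_def by (rule openin_topology_generated_by)
  \<comment> \<open>Membership in \<open>wspace w\<close> is carried through the induction, since
    seminorms of differences are controlled only inside the space.\<close>
  then have "\<forall>x\<in>U. x \<in> wspace w \<and> (\<exists>k\<ge>1. \<exists>e>0. wball k x e \<subseteq> U)"
  proof induction
    case Empty
    then show ?case by simp
  next
    case (Int a b)
    show ?case
    proof
      fix x assume x: "x \<in> a \<inter> b"
      with Int.IH obtain k e l d where *: "1 \<le> k" "0 < e" "wball k x e \<subseteq> a"
        "1 \<le> l" "0 < d" "wball l x d \<subseteq> b" and xw: "x \<in> wspace w" by blast
      have "wball (max k l) x (min e d) \<subseteq> wball k x e \<inter> wball l x d"
        unfolding wball_def
        using wnorm_mono[OF diff_in_wspace[OF _ xw], of _ k "max k l"]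
          wnorm_mono[OF diff_in_wspace[OF _ xw], of _ l "max k l"] *
        by fastforce
      moreover have "1 \<le> max k l" "0 < min e d" using * by auto
      ultimately show "x \<in> wspace w \<and> (\<exists>k\<ge>1. \<exists>e>0. wball k x e \<subseteq> a \<inter> b)"
        using * xw by (meson Int_mono order_trans)
    qed
  next
    case (UN K)
    then show ?case by (meson Union_iff Union_upper order_trans)
  next
    case (Basis s)
    then obtain k z d where s: "s = wball k z d" and k: "1 \<le> k" and z: "z \<in> wspace w" and "0 < d"
      unfolding wball_def by auto
    show ?case
    proof
      fix x assume x: "x \<in> s"
      then have xw: "x \<in> wspace w" and lt: "wnorm w k (\<lambda>n. x n - z n) < d"
        unfolding s wball_def by auto
      \<comment> \<open>The radius is the slack that the distance from \<open>x\<close> to the old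
        centre \<open>z\<close> leaves.\<close>
      have "wball k x (d - wnorm w k (\<lambda>n. x n - z n)) \<subseteq> s"
        unfolding s wball_def using wnorm_diff_triangle[OF _ xw z k] by fastforce
      with xw lt k show "x \<in> wspace w \<and> (\<exists>k\<ge>1. \<exists>e>0. wball k x e \<subseteq> s)"
        by (meson diff_gt_0_iff_gt)
    qed
  qed
  with assms(2) that show thesis by blast
qed

lemma centre_in_wball: "\<lbrakk>x \<in> wspace w; 0 < e\<rbrakk> \<Longrightarrow> x \<in> wball k x e"
  unfolding wball_def by simp

lemma openin_wtopI:
  assumes "U \<subseteq> wspace w" "\<And>x. x \<in> U \<Longrightarrow> \<exists>k\<ge>1. \<exists>e>0. wball k x e \<subseteq> U"
  shows "openin (wtop w) U"
proof (subst openin_subopen, intro ballI)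
  fix x assume "x \<in> U"
  with assms obtain k e where "1 \<le> k" "0 < e" "wball k x e \<subseteq> U" by blast
  with \<open>x \<in> U\<close> assms(1) show "\<exists>T. openin (wtop w) T \<and> x \<in> T \<and> T \<subseteq> U"
    by (meson centre_in_wball openin_wball subsetD)
qed

lemma limitin_wtopI:
  assumes y: "y \<in> wspace w" and f: "\<And>N. f N \<in> wspace w"
    and lim: "\<And>k. 1 \<le> k \<Longrightarrow> ((\<lambda>N. wnorm w k (\<lambda>n. f N n - y n)) \<longlongrightarrow> 0) F"
  shows "limitin (wtop w) f y F"
  unfolding limitin_def topspace_wtop
proof (intro conjI allI impI y)
  fix U assume "openin (wtop w) U \<and> y \<in> U"
  then obtain k e where k: "1 \<le> k" "0 < e" "wball k y e \<subseteq> U"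
    using openin_wtop_imp_wball by metis
  have "eventually (\<lambda>N. wnorm w k (\<lambda>n. f N n - y n) < e) F"
    using order_tendstoD(2)[OF lim[OF k(1)] k(2)] .
  then show "eventually (\<lambda>N. f N \<in> U) F"
    by (rule eventually_mono) (use k f in \<open>auto simp: wball_def\<close>)
qed

text \<open>Coordinate functionals are continuous: a single term of the first seminorm is at most
  that seminorm, and its weight \<open>w 1 n\<close> is positive.\<close>

lemma limitin_wtop_coordinate:
  assumes lim: "limitin (wtop w) f y F" and n: "1 \<le> n"
  shows "((\<lambda>N. f N n) \<longlongrightarrow> y n) F"
proof (rule tendstoI)
  fix e :: real assume e: "0 < e"
  have y: "y \<in> wspace w" using limitin_topspace[OF lim] by (simp add: topspace_wtop)
  have w: "0 < w 1 n" using weight_pos n by simp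
  have "eventually (\<lambda>N. f N \<in> wball 1 y (e * w 1 n)) F"
    using lim y e w openin_wball[of 1 y "e * w 1 n"] centre_in_wball[of y "e * w 1 n" 1]
    unfolding limitin_def by simp
  then show "eventually (\<lambda>N. dist (f N n) (y n) < e) F"
  proof (rule eventually_mono)
    fix N assume "f N \<in> wball 1 y (e * w 1 n)"
    then have "norm (f N n - y n) * w 1 n < e * w 1 n"
      using coordinate_le_wnorm[OF diff_in_wspace[OF _ y], of "f N" 1 n] n
      unfolding wball_def by simp
    then show "dist (f N n) (y n) < e" using w by (simp add: dist_norm)
  qed
qed

text \<open>Limits are determined coordinatewise; at index 0 both vanish by the normalisation. This
  justifies the definite description in \<open>hankel\<close>.\<close>

lemma limitin_wtop_unique:
  assumes "limitin (wtop w) f y F" "limitin (wtop w) f z F" "F \<noteq> bot"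
  shows "y = z"
proof
  fix n
  show "y n = z n"
  proof (cases "n = 0")
    case True
    then show ?thesis
      using limitin_topspace[OF assms(1)] limitin_topspace[OF assms(2)]
      by (simp add: topspace_wtop wspace_0)
  next
    case False
    then show ?thesis
      using tendsto_unique[OF assms(3) limitin_wtop_coordinate[OF assms(1)]
          limitin_wtop_coordinate[OF assms(2)]] by simp
  qed
qed

lemma zero_nbhd_wball: "\<lbrakk>1 \<le> k; 0 < e\<rbrakk> \<Longrightarrow> zero_nbhd (wtop w) (wball k (\<lambda>_. 0) e)"
  unfolding zero_nbhd_def topspace_wtop
  using openin_wball[OF _ zero_in_wspace] centre_in_wball[OF zero_in_wspace]
  by (intro conjI exI[of _ "wball k (\<lambda>_. 0) e"]) (auto simp: wball_def)

section \<open>Truncations, tails and finitely supported sequences\<close>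

lemma truncate_in_wspace:
  assumes "x \<in> wspace w"
  shows "(\<lambda>n. if n \<le> N then 0 else x n) \<in> wspace w"
    and "(\<lambda>n. if n \<le> N then x n else 0) \<in> wspace w"
proof -
  show "(\<lambda>n. if n \<le> N then 0 else x n) \<in> wspace w"
    by (intro wspaceI summable_on_comparison_test[OF wspace_summable[OF assms]])
      (auto simp: weight_nonneg)
  show "(\<lambda>n. if n \<le> N then x n else 0) \<in> wspace w"
    by (intro wspaceI summable_on_comparison_test[OF wspace_summable[OF assms]])
      (auto simp: weight_nonneg wspace_0[OF assms])
qed

text \<open>The seminorm of the tail is the unordered sum minus the sum over \<open>{1..N}\<close>.
  Convergence along finite sets gives a finite \<open>A\<close> all of whose finite supersets have
  sums close to the total, and \<open>{1..N}\<close> is such a superset for large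
  \<open>N\<close>.\<close>

lemma wnorm_tail_tendsto_0:
  assumes x: "x \<in> wspace w" and k: "1 \<le> k"
  shows "(\<lambda>N. wnorm w k (\<lambda>n. if n \<le> N then 0 else x n)) \<longlonglongrightarrow> 0"
proof (rule LIMSEQ_I)
  fix e :: real assume e: "0 < e"
  let ?f = "\<lambda>n. norm (x n) * w k n"
  have s: "?f summable_on {1..}" using wspace_summable[OF x k] .
  then have "(sum ?f \<longlongrightarrow> infsum ?f {1..}) (finite_subsets_at_top {1..})"
    using has_sum_infsum unfolding has_sum_def by blast
  from tendstoD[OF this e] obtain A where A: "finite A" "A \<subseteq> {1..}"
    and close: "\<forall>Y. finite Y \<and> A \<subseteq> Y \<and> Y \<subseteq> {1..} \<longrightarrow> dist (sum ?f Y) (infsum ?f {1..}) < e"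
    unfolding eventually_finite_subsets_at_top by (elim exE conjE)
  obtain M where M: "A \<subseteq> {..M}" using A(1) finite_nat_iff_bounded_le by blast
  show "\<exists>M. \<forall>N\<ge>M. norm (wnorm w k (\<lambda>n. if n \<le> N then 0 else x n) - 0) < e"
  proof (intro exI allI impI)
    fix N assume N: "M \<le> N"
    have split: "{1..} = {1..N} \<union> {N<..}" for N :: nat by auto
    have fin: "?f summable_on {1..N}" by (rule summable_on_finite) simp
    have inf: "?f summable_on {N<..}" by (rule summable_on_subset_banach[OF s]) auto
    have "wnorm w k (\<lambda>n. if n \<le> N then 0 else x n) = infsum ?f {N<..}"
      unfolding wnorm_def by (rule infsum_cong_neutral) auto
    also have "\<dots> = infsum ?f {1..} - sum ?f {1..N}"
    proof -
      have "{1..N} \<inter> {N<..} = {}" by auto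
      from infsum_Un_disjoint[OF fin inf this] show ?thesis unfolding split[of N] by simp
    qed
    also have "\<dots> < e"
    proof -
      have "A \<subseteq> {1..N}" using A M N by force
      then have "dist (sum ?f {1..N}) (infsum ?f {1..}) < e"
        by (intro close[rule_format]) auto
      then show ?thesis by (simp only: dist_real_def)
    qed
    finally show "norm (wnorm w k (\<lambda>n. if n \<le> N then 0 else x n) - 0) < e"
      by (simp add: wnorm_nonneg[OF k])
  qed
qed

lemma wnorm_finite_support:
  assumes "\<And>n. N < n \<Longrightarrow> x n = 0"
  shows "wnorm w k x = (\<Sum>n=1..N. norm (x n) * w k n)"
proof -
  have "wnorm w k x = (\<Sum>\<^sub>\<infinity>n\<in>{1..N}. norm (x n) * w k n)"
    unfolding wnorm_def by (rule infsum_cong_neutral) (auto simp: assms)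
  then show ?thesis by simp
qed

lemma finite_support_in_wspace:
  assumes "x 0 = 0" "\<And>n. N < n \<Longrightarrow> x n = 0"
  shows "x \<in> wspace w"
proof (rule wspaceI)
  fix k :: nat assume "1 \<le> k"
  have "(\<lambda>n. norm (x n) * w k n) summable_on {1..N}" by (rule summable_on_finite) simp
  then show "(\<lambda>n. norm (x n) * w k n) summable_on {1..}"
    by (rule summable_on_cong_neutral[THEN iffD1, rotated -1]) (auto simp: assms)
qed (rule assms)

end

section \<open>Bounded sets are precompact under the Schwartz condition\<close>

text \<open>The closure is compact by the Heine-Borel property, hence totally bounded. The centres
  need not lie in \<open>S\<close>, which agrees with the form of
  \<open>precompact_in\<close>.\<close>

lemma bounded_imp_finite_net:
  fixes S :: "'a::{real_normed_vector,heine_borel} set"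
  assumes "bounded S" "0 < e"
  obtains D where "finite D" "\<And>s. s \<in> S \<Longrightarrow> \<exists>d\<in>D. norm (s - d) < e"
proof -
  have "compact (closure S)" using assms(1) by simp
  then obtain D where "finite D" "closure S \<subseteq> (\<Union>x\<in>D. ball x e)"
    using assms(2) unfolding compact_eq_totally_bounded by meson
  moreover have "\<exists>d\<in>D. norm (s - d) < e" if "s \<in> S" for s
  proof -
    have "s \<in> (\<Union>x\<in>D. ball x e)" using that closure_subset calculation(2) by blast
    then show ?thesis by (auto simp: dist_norm norm_minus_commute)
  qed
  ultimately show thesis using that by blast
qed

text \<open>The extra condition says that for each \<open>k\<close> some \<open>l\<close> makes the
  ratio \<open>w k n / w l n\<close> tend to 0, the classical criterion for a Koethe space to be a
  Schwartz space.\<close>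

locale schwartz_weights = koethe_weights +
  assumes schwartz: "1 \<le> k \<Longrightarrow> \<exists>l\<ge>1. \<forall>e>0. \<exists>N. \<forall>n>N. w k n \<le> e * w l n"
begin

text \<open>The Schwartz condition makes the tails beyond some \<open>N\<close> uniformly small on
  \<open>K\<close>, and the first \<open>N\<close> coordinates range over bounded sets of scalars,
  which have finite nets.\<close>

lemma bounded_imp_precompact:
  fixes K :: "(nat \<Rightarrow> 'a::{real_normed_field,heine_borel}) set"
  assumes K: "K \<subseteq> wspace w"
    and bounded: "\<And>k. 1 \<le> k \<Longrightarrow> \<exists>C. \<forall>y\<in>K. wnorm w k y \<le> C"
  shows "precompact_in (wtop w) K"
  unfolding precompact_in_def topspace_wtop
proof (intro conjI allI impI K)
  fix V :: "(nat \<Rightarrow> 'a) set" assume "zero_nbhd (wtop w) V"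
  then obtain k e where k: "1 \<le> k" and e: "0 < e" and V: "wball k (\<lambda>_. 0) e \<subseteq> V"
    unfolding zero_nbhd_def using openin_wtop_imp_wball by (metis order_trans)
  obtain l where l: "1 \<le> l" and small: "\<And>d. 0 < d \<Longrightarrow> \<exists>N. \<forall>n>N. w k n \<le> d * w l n"
    using schwartz[OF k] by blast
  obtain C where C: "\<And>y. y \<in> K \<Longrightarrow> wnorm w l y \<le> C" using bounded[OF l] by blast
  \<comment> \<open>Raising the bound to at least 1 makes it a legitimate divisor; \<open>d\<close>
    is then chosen so that the tails cost at most \<open>e / 2\<close>.\<close>
  define C' where "C' = max C 1"
  have C': "0 < C'" "\<And>y. y \<in> K \<Longrightarrow> wnorm w l y \<le> C'" using C unfolding C'_def by force+
  define d where "d = e / (2 * C')"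
  have d: "0 < d" using e C' unfolding d_def by simp
  obtain N where N: "\<And>n. N < n \<Longrightarrow> w k n \<le> d * w l n" using small[OF d] by blast
  have tail: "wnorm w k (\<lambda>n. if n \<le> N then 0 else y n) \<le> e / 2" if y: "y \<in> K" for y
  proof -
    have yw: "y \<in> wspace w" using y K by blast
    have "wnorm w k (\<lambda>n. if n \<le> N then 0 else y n) \<le> (\<Sum>\<^sub>\<infinity>n\<in>{1..}. d * (norm (y n) * w l n))"
      unfolding wnorm_def
    proof (rule infsum_mono)
      show "(\<lambda>n. norm (if n \<le> N then 0 else y n) * w k n) summable_on {1..}"
        by (rule wspace_summable[OF truncate_in_wspace(1)[OF yw] k])
      show "(\<lambda>n. d * (norm (y n) * w l n)) summable_on {1..}"
        by (rule summable_on_cmult_right[OF wspace_summable[OF yw l]])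
      fix n :: nat assume "n \<in> {1..}"
      then show "norm (if n \<le> N then 0 else y n) * w k n \<le> d * (norm (y n) * w l n)"
        using mult_left_mono[OF N[of n], of "norm (y n)"] weight_nonneg[of l n] d l
        by (auto simp: mult_ac)
    qed
    also have "\<dots> = d * wnorm w l y" unfolding wnorm_def by (simp add: infsum_cmult_right')
    also have "\<dots> \<le> d * C'" using C'(2)[OF y] d by simp
    also have "\<dots> = e / 2" using C' unfolding d_def by simp
    finally show ?thesis .
  qed
  \<comment> \<open>The denominator uses \<open>N + 1\<close> so that it is nonzero for
    \<open>N = 0\<close> and the \<open>N\<close> coordinate errors add up to strictly less than
    \<open>e / 2\<close>.\<close>
  have "\<exists>D. finite D \<and> (\<forall>y\<in>K. \<exists>c\<in>D. norm (y n - c) * w k n < e / (2 * (real N + 1)))"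
    if n: "n \<in> {1..N}" for n
  proof -
    have w: "0 < w k n" "0 < w l n" using weight_pos n k l by auto
    have "norm (y n) \<le> C' / w l n" if "y \<in> K" for y
      using coordinate_le_wnorm[of y l n] C'(2)[OF that] that K n l w by (force simp: field_simps)
    then have "bounded ((\<lambda>y. y n) ` K)" unfolding bounded_iff by auto
    moreover have "0 < e / (2 * (real N + 1)) / w k n" using e w by simp
    ultimately obtain D where "finite D"
      "\<And>s. s \<in> (\<lambda>y. y n) ` K \<Longrightarrow> \<exists>c\<in>D. norm (s - c) < e / (2 * (real N + 1)) / w k n"
      using bounded_imp_finite_net by metis
    then show ?thesis
      unfolding pos_less_divide_eq[OF w(1)] by (intro exI[of _ D]) auto
  qed
  then obtain D where finD: "\<And>n. n \<in> {1..N} \<Longrightarrow> finite (D n)"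
    and D: "\<And>n y. \<lbrakk>n \<in> {1..N}; y \<in> K\<rbrakk> \<Longrightarrow> \<exists>c\<in>D n. norm (y n - c) * w k n < e / (2 * (real N + 1))"
    by metis
  \<comment> \<open>The net consists of all combinations of coordinatewise centres, extended by
    zero.\<close>
  define T where "T = (\<lambda>f n. if n \<in> {1..N} then f n else 0) ` (PiE {1..N} D)"
  have "finite T" unfolding T_def by (intro finite_imageI finite_PiE finD) auto
  moreover have Tw: "T \<subseteq> wspace w"
    unfolding T_def by (auto intro!: finite_support_in_wspace[where N = N])
  moreover have "y \<in> (\<Union>t\<in>T. (\<lambda>v n. t n + v n) ` V)" if y: "y \<in> K" for y
  proof -
    have yw: "y \<in> wspace w" using y K by blast
    obtain f where f: "\<And>n. n \<in> {1..N} \<Longrightarrow> f n \<in> D n \<and> norm (y n - f n) * w k n < e / (2 * (real N + 1))"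
      using D[OF _ y] by metis
    define t where "t = (\<lambda>n. if n \<in> {1..N} then f n else 0)"
    have tT: "t \<in> T"
      unfolding T_def t_def using f
      \<comment> \<open>Elements of \<open>PiE\<close> are \<open>undefined\<close> off
        \<open>{1..N}\<close>, hence the restriction of \<open>f\<close>.\<close>
      by (intro image_eqI[where x = "restrict f {1..N}"]) auto
    with Tw have tw: "t \<in> wspace w" by blast
    let ?h = "\<lambda>n. if n \<le> N then y n - t n else 0" and ?r = "\<lambda>n. if n \<le> N then 0 else y n"
    have hw: "?h \<in> wspace w" using truncate_in_wspace(2)[OF diff_in_wspace[OF yw tw]] .
    have "wnorm w k ?h = (\<Sum>n=1..N. norm (?h n) * w k n)"
      by (rule wnorm_finite_support) simp
    also have "\<dots> \<le> (\<Sum>n=1..N. e / (2 * (real N + 1)))"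
      by (rule sum_mono) (use f in \<open>auto simp: t_def intro: less_imp_le\<close>)
    also have "\<dots> = real N * (e / (2 * (real N + 1)))" by simp
    also have "\<dots> < e / 2" using e by (simp add: field_simps)
    finally have h: "wnorm w k ?h < e / 2" .
    \<comment> \<open>Beyond \<open>N\<close> the sequence \<open>t\<close> vanishes, so the
      difference there is just the tail of \<open>y\<close>.\<close>
    have "(\<lambda>n. y n - t n) = (\<lambda>n. ?h n + ?r n)" by (auto simp: t_def)
    then have "wnorm w k (\<lambda>n. y n - t n) \<le> wnorm w k ?h + wnorm w k ?r"
      using wnorm_add_le[OF hw truncate_in_wspace(1)[OF yw] k] by simp
    then have "(\<lambda>n. y n - t n) \<in> wball k (\<lambda>_. 0) e"
      using h tail[OF y] diff_in_wspace[OF yw tw] unfolding wball_def by simp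
    then have "(\<lambda>n. y n - t n) \<in> V" using V by blast
    then have "y \<in> (\<lambda>v n. t n + v n) ` V"
      by (rule rev_image_eqI) simp
    then show ?thesis using tT by blast
  qed
  ultimately show "\<exists>T. finite T \<and> T \<subseteq> wspace w \<and> K \<subseteq> (\<Union>t\<in>T. (\<lambda>v n. t n + v n) ` V)"
    by blast
qed

end

section \<open>Operators given by their columns\<close>

text \<open>The operator sending \<open>e_n\<close> to \<open>T n\<close>, first taken as a
  coordinatewise unordered sum, so that double series can be rearranged before any convergence in
  the topology is known.\<close>

definition column_sum :: "(nat \<Rightarrow> nat \<Rightarrow> 'a::real_normed_field) \<Rightarrow> (nat \<Rightarrow> 'a) \<Rightarrow> nat \<Rightarrow> 'a" where
  "column_sum T x = (\<lambda>j. \<Sum>\<^sub>\<infinity>n\<in>{1..}. x n * T n j)"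

text \<open>One index \<open>p\<close> serves every target seminorm \<open>k\<close>; only the
  constant \<open>C k\<close> varies. Thus the image of a single \<open>p\<close>-ball is bounded in
  all seminorms at once, which is the source of compactness.\<close>

locale column_bound = E: koethe_weights w + F: koethe_weights v
  for w v :: "nat \<Rightarrow> nat \<Rightarrow> real" +
  fixes T :: "nat \<Rightarrow> nat \<Rightarrow> 'a::{real_normed_field,banach}" and p :: nat and C :: "nat \<Rightarrow> real"
  assumes p: "1 \<le> p"
    and column_in: "1 \<le> n \<Longrightarrow> T n \<in> wspace v"
    and column_le: "\<lbrakk>1 \<le> k; 1 \<le> n\<rbrakk> \<Longrightarrow> wnorm v k (T n) \<le> C k * w p n"
begin

lemma column_sum_0: "column_sum T x 0 = 0"
  unfolding column_sum_def using column_in F.wspace_0 by (intro infsum_0) auto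

text \<open>Fubini for the double series with terms \<open>F k n j\<close>. Summing over
  \<open>j\<close> first produces the column seminorms, whose bound makes the series summable;
  summing over \<open>n\<close> first then dominates the coordinates of the image.\<close>

lemma
  assumes x: "x \<in> wspace w"
  shows column_sum_summable: "1 \<le> j \<Longrightarrow> (\<lambda>n. x n * T n j) summable_on {1..}"
    and column_sum_in: "column_sum T x \<in> wspace v"
    and column_sum_le: "1 \<le> k \<Longrightarrow> wnorm v k (column_sum T x) \<le> C k * wnorm w p x"
proof -
  define F where "F k n j = norm (x n) * (norm (T n j) * v k j)" for k n j
  have F0: "0 \<le> F k n j" if "1 \<le> k" "1 \<le> j" for k n j
    unfolding F_def using F.weight_nonneg that by simp
  have inner: "((\<lambda>j. F k n j) has_sum norm (x n) * wnorm v k (T n)) {1..}" if "1 \<le> k" "1 \<le> n" for k n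
    unfolding F_def wnorm_def
    by (intro has_sum_cmult_right has_sum_infsum F.wspace_summable column_in that)
  have outer_le: "norm (x n) * wnorm v k (T n) \<le> C k * (norm (x n) * w p n)" if "1 \<le> k" "1 \<le> n" for k n
    using mult_left_mono[OF column_le[OF that], of "norm (x n)"] by (simp add: mult_ac)
  have sC: "(\<lambda>n. C k * (norm (x n) * w p n)) summable_on {1..}" for k
    by (rule summable_on_cmult_right[OF E.wspace_summable[OF x p]])
  have outer: "(\<lambda>n. norm (x n) * wnorm v k (T n)) summable_on {1..}" if "1 \<le> k" for k
    by (rule summable_on_comparison_test[OF sC[of k]]) (use outer_le F.wnorm_nonneg that in \<open>auto intro!: mult_nonneg_nonneg\<close>)
  have F: "(\<lambda>(n, j). F k n j) summable_on ({1..} \<times> {1..})" if "1 \<le> k" for k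
    by (rule summable_on_SigmaI[OF _ outer[OF that]]) (use inner F0 that in auto)
  have F': "(\<lambda>(j, n). F k n j) summable_on ({1..} \<times> {1..})" if "1 \<le> k" for k
    using F[OF that] by (subst summable_on_swap) simp
  have row: "(\<lambda>n. F k n j) summable_on {1..}" if "1 \<le> k" "1 \<le> j" for k j
    using summable_on_SigmaD1[OF F'[OF that(1)], of j] that by simp
  have abs: "(\<lambda>n. x n * T n j) abs_summable_on {1..}" if "1 \<le> j" for j
  proof -
    \<comment> \<open>The positive weight \<open>v 1 j\<close> does not depend on \<open>n\<close>
      and can be cancelled.\<close>
    have "(\<lambda>n. norm (x n * T n j) * v 1 j) summable_on {1..}"
      using row[OF order_refl that] by (simp add: F_def norm_mult mult_ac)
    then show ?thesis
      using F.weight_pos[OF order_refl that] by (simp add: summable_on_cmult_left')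
  qed
  show "(\<lambda>n. x n * T n j) summable_on {1..}" if "1 \<le> j"
    by (rule abs_summable_summable[OF abs[OF that]])
  have le: "norm (column_sum T x j) * v k j \<le> (\<Sum>\<^sub>\<infinity>n\<in>{1..}. F k n j)" if "1 \<le> k" "1 \<le> j" for k j
  proof -
    have "norm (column_sum T x j) \<le> (\<Sum>\<^sub>\<infinity>n\<in>{1..}. norm (x n * T n j))"
      unfolding column_sum_def by (rule norm_infsum_bound[OF abs[OF that(2)]])
    from mult_right_mono[OF this F.weight_nonneg[OF that]]
    show ?thesis
      by (simp add: F_def norm_mult mult.assoc flip: infsum_cmult_left')
  qed
  have rows: "(\<lambda>j. \<Sum>\<^sub>\<infinity>n\<in>{1..}. F k n j) summable_on {1..}" if "1 \<le> k" for k
    by (rule summable_on_Sigma_banach[OF F'[OF that]])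
  have s: "(\<lambda>j. norm (column_sum T x j) * v k j) summable_on {1..}" if "1 \<le> k" for k
    by (rule summable_on_comparison_test[OF rows[OF that]]) (use le F.weight_nonneg that in auto)
  show "column_sum T x \<in> wspace v" by (rule F.wspaceI[OF column_sum_0 s])
  show "wnorm v k (column_sum T x) \<le> C k * wnorm w p x" if k: "1 \<le> k"
  proof -
    have "wnorm v k (column_sum T x) \<le> (\<Sum>\<^sub>\<infinity>j\<in>{1..}. \<Sum>\<^sub>\<infinity>n\<in>{1..}. F k n j)"
      unfolding wnorm_def by (rule infsum_mono[OF s[OF k] rows[OF k]]) (use le k in auto)
    also have "\<dots> = (\<Sum>\<^sub>\<infinity>n\<in>{1..}. \<Sum>\<^sub>\<infinity>j\<in>{1..}. F k n j)"
      by (rule infsum_swap_banach[OF F'[OF k]])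
    also have "\<dots> = (\<Sum>\<^sub>\<infinity>n\<in>{1..}. norm (x n) * wnorm v k (T n))"
      by (rule infsum_cong) (use infsumI[OF inner[OF k]] in auto)
    also have "\<dots> \<le> (\<Sum>\<^sub>\<infinity>n\<in>{1..}. C k * (norm (x n) * w p n))"
      by (rule infsum_mono[OF outer[OF k] sC]) (use outer_le k in auto)
    also have "\<dots> = C k * wnorm w p x"
      unfolding wnorm_def by (simp add: infsum_cmult_right')
    finally show ?thesis .
  qed
qed

lemma column_sum_lincomb:
  assumes "x \<in> wspace w" "y \<in> wspace w"
  shows "column_sum T (\<lambda>n. a * x n + b * y n) = (\<lambda>j. a * column_sum T x j + b * column_sum T y j)"
proof
  fix j
  show "column_sum T (\<lambda>n. a * x n + b * y n) j = a * column_sum T x j + b * column_sum T y j"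
  proof (cases "j = 0")
    case True
    then show ?thesis by (simp add: column_sum_0)
  next
    case False
    then have s: "(\<lambda>n. a * (x n * T n j)) summable_on {1..}" "(\<lambda>n. b * (y n * T n j)) summable_on {1..}"
      using assms by (auto intro!: summable_on_cmult_right column_sum_summable simp del: One_nat_def)
    show ?thesis
      using infsum_add[OF s] unfolding column_sum_def
      by (simp add: algebra_simps infsum_cmult_right')
  qed
qed

lemma column_sum_diff:
  assumes "x \<in> wspace w" "y \<in> wspace w"
  shows "column_sum T (\<lambda>n. x n - y n) = (\<lambda>j. column_sum T x j - column_sum T y j)"
  using column_sum_lincomb[OF assms, of 1 "-1"] by simp

text \<open>The \<open>N\<close>-th partial sum is the image of the truncation of \<open>x\<close>,
  so the error is, up to sign, the image of the tail, whose seminorm is at most \<open>C k\<close>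
  times a null sequence.\<close>

lemma column_partial_sums_limit:
  assumes x: "x \<in> wspace w"
  shows "limitin (wtop v) (\<lambda>N j. \<Sum>n=1..N. x n * T n j) (column_sum T x) sequentially"
proof -
  let ?h = "\<lambda>N n. if n \<le> N then x n else 0" and ?r = "\<lambda>N n. if n \<le> N then 0 else x n"
  have h: "(\<lambda>j. \<Sum>n=1..N. x n * T n j) = column_sum T (?h N)" for N
  proof
    fix j
    have "column_sum T (?h N) j = (\<Sum>\<^sub>\<infinity>n\<in>{1..N}. x n * T n j)"
      unfolding column_sum_def by (rule infsum_cong_neutral) auto
    then show "(\<Sum>n=1..N. x n * T n j) = column_sum T (?h N) j" by simp
  qed
  have r: "column_sum T (?r N) j = column_sum T x j - column_sum T (?h N) j" for N j
    using fun_cong[OF column_sum_diff[OF x E.truncate_in_wspace(2)[OF x]], of N j]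
    by (simp add: if_distrib cong: if_cong)
  show ?thesis
    unfolding h
  proof (rule F.limitin_wtopI)
    fix k :: nat assume k: "1 \<le> k"
    have eq: "wnorm v k (\<lambda>j. column_sum T (?h N) j - column_sum T x j) = wnorm v k (column_sum T (?r N))" for N
      unfolding wnorm_def r by (simp add: norm_minus_commute)
    show "(\<lambda>N. wnorm v k (\<lambda>j. column_sum T (?h N) j - column_sum T x j)) \<longlonglongrightarrow> 0"
      unfolding eq
    proof (rule tendsto_sandwich[OF always_eventually always_eventually tendsto_const])
      show "\<forall>N. 0 \<le> wnorm v k (column_sum T (?r N))" using F.wnorm_nonneg[OF k] by blast
      show "\<forall>N. wnorm v k (column_sum T (?r N)) \<le> C k * wnorm w p (?r N)"
        using column_sum_le[OF E.truncate_in_wspace(1)[OF x] k] by blast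
      show "(\<lambda>N. C k * wnorm w p (?r N)) \<longlonglongrightarrow> 0"
        using tendsto_mult_right_zero[OF E.wnorm_tail_tendsto_0[OF x p]] .
    qed
  qed (auto intro!: column_sum_in E.truncate_in_wspace x)
qed

lemma continuous_map_column_sum: "continuous_map (wtop w) (wtop v) (column_sum T)"
  unfolding continuous_map topspace_wtop
proof (intro conjI allI impI)
  show "column_sum T ` wspace w \<subseteq> wspace v" using column_sum_in by auto
  fix U :: "(nat \<Rightarrow> 'a) set" assume U: "openin (wtop v) U"
  show "openin (wtop w) {x \<in> wspace w. column_sum T x \<in> U}"
  proof (rule E.openin_wtopI)
    fix x assume "x \<in> {x \<in> wspace w. column_sum T x \<in> U}"
    then have x: "x \<in> wspace w" and "column_sum T x \<in> U" by auto
    then obtain k e where k: "1 \<le> k" and e: "0 < e" and ball: "F.wball k (column_sum T x) e \<subseteq> U"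
      using F.openin_wtop_imp_wball[OF U] by metis
    \<comment> \<open>No sign of \<open>C k\<close> is assumed; \<open>\<bar>C k\<bar> + 1\<close>
      is a positive upper bound for it.\<close>
    define d where "d = e / (\<bar>C k\<bar> + 1)"
    have d: "0 < d" unfolding d_def using e by (simp add: add_nonneg_pos)
    have "E.wball p x d \<subseteq> {x \<in> wspace w. column_sum T x \<in> U}"
    proof
      fix y assume "y \<in> E.wball p x d"
      then have y: "y \<in> wspace w" and lt: "wnorm w p (\<lambda>n. y n - x n) < d"
        unfolding E.wball_def by auto
      have "wnorm v k (\<lambda>j. column_sum T y j - column_sum T x j) \<le> C k * wnorm w p (\<lambda>n. y n - x n)"
        using column_sum_le[OF E.diff_in_wspace[OF y x] k] column_sum_diff[OF y x] by simp
      also have "\<dots> \<le> (\<bar>C k\<bar> + 1) * wnorm w p (\<lambda>n. y n - x n)"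
        by (rule mult_right_mono) (use E.wnorm_nonneg[OF p] in auto)
      also have "\<dots> < (\<bar>C k\<bar> + 1) * d"
        by (rule mult_strict_left_mono[OF lt]) simp
      also have "\<dots> = e" unfolding d_def by simp
      finally show "y \<in> {x \<in> wspace w. column_sum T x \<in> U}"
        using ball y column_sum_in[OF y] unfolding F.wball_def by auto
    qed
    then show "\<exists>k\<ge>1. \<exists>e>0. E.wball k x e \<subseteq> {x \<in> wspace w. column_sum T x \<in> U}"
      using p d by blast
  qed auto
qed

end

text \<open>The unit ball of the \<open>p\<close>-th seminorm is mapped to a set on which the
  \<open>k\<close>-th seminorm is at most \<open>\<bar>C k\<bar>\<close> for every \<open>k\<close>;
  such sets are precompact in the target.\<close>

lemma compact_operator_column_sum:
  fixes T :: "nat \<Rightarrow> nat \<Rightarrow> 'a::{real_normed_field,banach,heine_borel}"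
  assumes "column_bound w v T p C" "schwartz_weights v"
  shows "compact_operator (wtop w) (wtop v) (column_sum T)"
proof -
  interpret column_bound w v T p C by fact
  interpret F: schwartz_weights v by fact
  show ?thesis
    unfolding compact_operator_def linear_map_on_def topspace_wtop
  proof (intro conjI ballI allI exI)
    show "zero_nbhd (wtop w) (E.wball p (\<lambda>_. 0) 1 :: (nat \<Rightarrow> 'a) set)"
      by (rule E.zero_nbhd_wball[OF p]) simp
    show "precompact_in (wtop v) (column_sum T ` E.wball p (\<lambda>_. 0) 1)"
    proof (rule F.bounded_imp_precompact)
      fix k :: nat assume k: "1 \<le> k"
      have "wnorm v k (column_sum T x) \<le> \<bar>C k\<bar>" if "x \<in> E.wball p (\<lambda>_. 0) 1" for x
      proof -
        have x: "x \<in> wspace w" "wnorm w p x < 1" using that unfolding E.wball_def by auto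
        have "C k * wnorm w p x \<le> \<bar>C k\<bar> * 1"
          using x(2) E.wnorm_nonneg[OF p, of x] by (intro mult_mono) auto
        then show ?thesis using column_sum_le[OF x(1) k] by linarith
      qed
      then show "\<exists>D. \<forall>y\<in>column_sum T ` E.wball p (\<lambda>_. 0) 1. wnorm v k y \<le> D" by blast
    qed (auto simp: E.wball_def intro: column_sum_in)
  qed (rule column_sum_lincomb)
qed

section \<open>Power series spaces as instances\<close>

lemma koethe_weights_inf:
  assumes "exponent_sequence \<alpha>"
  shows "koethe_weights (\<lambda>k n. exp (real k * \<alpha> n))"
  by unfold_locales (use assms in \<open>auto simp: exponent_sequence_def intro: mult_right_mono\<close>)

text \<open>For \<open>l = k + 1\<close> the ratio of the weights is
  \<open>exp (- c * \<beta> n)\<close> with \<open>c = 1/k - 1/(k+1) > 0\<close>, which tends to 0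
  because \<open>\<beta>\<close> tends to infinity.\<close>

lemma schwartz_weights_1:
  assumes "exponent_sequence \<beta>"
  shows "schwartz_weights (\<lambda>k n. exp (- (1 / real k) * \<beta> n))"
proof unfold_locales
  fix k l n :: nat
  assume "1 \<le> k" "k \<le> l" "1 \<le> n"
  then show "exp (- (1 / real k) * \<beta> n) \<le> exp (- (1 / real l) * \<beta> n)"
    using assms by (auto simp: exponent_sequence_def intro!: divide_left_mono)
next
  fix k :: nat assume k: "1 \<le> k"
  define c where "c = 1 / real k - 1 / real (Suc k)"
  have c: "0 < c" unfolding c_def using k by (simp add: frac_less2)
  have "\<exists>N. \<forall>n>N. exp (- (1 / real k) * \<beta> n) \<le> e * exp (- (1 / real (Suc k)) * \<beta> n)" if e: "0 < e" for e :: real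
  proof -
    \<comment> \<open>This is the condition that the ratio is at most \<open>e\<close>, solved for
      \<open>\<beta> n\<close>.\<close>
    have "eventually (\<lambda>n. - ln e / c \<le> \<beta> n) sequentially"
      using assms unfolding exponent_sequence_def filterlim_at_top by blast
    then obtain N where N: "\<And>n. N \<le> n \<Longrightarrow> - ln e / c \<le> \<beta> n"
      unfolding eventually_sequentially by blast
    have "exp (- (1 / real k) * \<beta> n) \<le> e * exp (- (1 / real (Suc k)) * \<beta> n)" if "N < n" for n
    proof -
      have "- ln e \<le> \<beta> n * c"
        using N[of n] that pos_divide_le_eq[OF c, of "- ln e" "\<beta> n"] by simp
      also have "\<dots> = 1 / real k * \<beta> n - 1 / real (Suc k) * \<beta> n"
        unfolding c_def by (simp only: right_diff_distrib mult.commute)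
      finally have "- (1 / real k) * \<beta> n \<le> ln e + - (1 / real (Suc k)) * \<beta> n"
        by linarith
      then have "exp (- (1 / real k) * \<beta> n) \<le> exp (ln e + - (1 / real (Suc k)) * \<beta> n)"
        by (rule exp_le_cancel_iff[THEN iffD2])
      then show ?thesis using e by (simp only: exp_add exp_ln)
    qed
    then show ?thesis by blast
  qed
  then show "\<exists>l\<ge>1. \<forall>e>0. \<exists>N. \<forall>n>N. exp (- (1 / real k) * \<beta> n) \<le> e * exp (- (1 / real l) * \<beta> n)"
    by (intro exI[of _ "Suc k"]) auto
qed simp

section \<open>Estimating the columns of the Hankel matrix\<close>

text \<open>Each weighted entry is dominated by a term depending on \<open>j\<close> only through
  \<open>m = j + n - 1\<close>. For fixed \<open>n\<close> this shift is injective, so the sum over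
  \<open>j\<close> is at most the sum of the majorant over all \<open>m\<close>, a combination of
  seminorms of \<theta>.\<close>

lemma hankel_column_bound:
  fixes \<theta> :: "nat \<Rightarrow> 'a::{real_normed_field,banach}"
  assumes \<beta>: "exponent_sequence \<beta>" and \<alpha>: "exponent_sequence \<alpha>"
    and stable: "stable_sequence \<beta>"
    and dom: "\<exists>A>0. \<exists>B>0. \<forall>n\<ge>1. \<beta> n \<le> A * \<alpha> n + B"
    and \<theta>: "reindex \<theta> \<in> wspace (\<lambda>k n. exp (- (1 / real k) * \<beta> n))"
  obtains p C where
    "column_bound (\<lambda>k n. exp (real k * \<alpha> n)) (\<lambda>k n. exp (- (1 / real k) * \<beta> n)) (hankel_col \<theta>) p C"
proof -
  let ?v = "\<lambda>k n. exp (- (1 / real k) * \<beta> n)" and ?w = "\<lambda>k n. exp (real k * \<alpha> n)"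
  interpret E: koethe_weights ?w by (rule koethe_weights_inf[OF \<alpha>])
  interpret F: schwartz_weights ?v by (rule schwartz_weights_1[OF \<beta>])
  have \<beta>0: "0 \<le> \<beta> n" and \<alpha>0: "0 \<le> \<alpha> n" if "1 \<le> n" for n
    using \<beta> \<alpha> that unfolding exponent_sequence_def by auto
  have \<beta>_mono: "\<beta> m \<le> \<beta> n" if "1 \<le> m" "m \<le> n" for m n
    using \<beta> that unfolding exponent_sequence_def mono_on_def by auto
  obtain M0 where M0: "\<And>n. 1 \<le> n \<Longrightarrow> \<beta> (2 * n) \<le> M0 * \<beta> n"
    using stable unfolding stable_sequence_def by blast
  \<comment> \<open>A natural \<open>M\<close> is chosen so that \<open>k * M\<close> is again a
    seminorm index.\<close>
  obtain M :: nat where M: "max 1 M0 \<le> real M" using real_arch_simple by blast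
  have M1: "1 \<le> M" using M by simp
  have stab: "\<beta> m \<le> real M * \<beta> n" if "1 \<le> n" "1 \<le> m" "m \<le> 2 * n" for m n
  proof -
    have "\<beta> m \<le> \<beta> (2 * n)" using \<beta>_mono that by simp
    also have "\<dots> \<le> M0 * \<beta> n" using M0 that by simp
    also have "\<dots> \<le> real M * \<beta> n" using M \<beta>0[OF that(1)] by (intro mult_right_mono) auto
    finally show ?thesis .
  qed
  obtain A B where A: "0 < A" and B: "\<And>n. 1 \<le> n \<Longrightarrow> \<beta> n \<le> A * \<alpha> n + B" using dom by blast
  \<comment> \<open>The growth rate \<open>M * A\<close> is rounded up to an index of the infinite
    type space.\<close>
  obtain p :: nat where p: "max 1 (real M * A) \<le> real p" using real_arch_simple by blast
  define D where "D = exp (real M * B)"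
  let ?r = "\<lambda>m. norm (reindex \<theta> m)"
  \<comment> \<open>The majorants of the two cases are added, so the summation needs no case split:
    the first is a term of seminorm \<open>k * M\<close> of \<theta>, the second a term of seminorm
    1 scaled by the weight of column \<open>n\<close>.\<close>
  define G where "G k n m = ?r m * ?v (k * M) m + D * ?w p n * (?r m * ?v 1 m)" for k n m
  have pointwise: "norm (hankel_col \<theta> n j) * ?v k j \<le> G k n (j + n - 1)"
    if k: "1 \<le> k" and n: "1 \<le> n" and j: "1 \<le> j" for k n j
  proof -
    define m where "m = j + n - 1"
    have m: "1 \<le> m" using j n unfolding m_def by simp
    \<comment> \<open>The entry is \<open>\<theta> (j + n - 2)\<close>, which sits at position
      \<open>m = j + n - 1\<close> after reindexing from 1.\<close>
    have col: "norm (hankel_col \<theta> n j) = ?r m"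
      using j n unfolding hankel_col_def reindex_def m_def by (simp add: numeral_2_eq_2)
    have "?v k j \<le> ?v (k * M) m + D * ?w p n * ?v 1 m"
    proof (cases "n \<le> j")
      case True
      then have "\<beta> m \<le> real M * \<beta> j" using j m by (intro stab) (simp_all add: m_def)
      then have "- (1 / real k) * \<beta> j \<le> - (1 / real (k * M)) * \<beta> m"
        using k M1 by (simp add: field_simps)
      then have "?v k j \<le> ?v (k * M) m" by (rule exp_le_cancel_iff[THEN iffD2])
      then show ?thesis unfolding D_def by (simp add: add_increasing2)
    next
      case False
      \<comment> \<open>Here \<open>j < n\<close>: the row weight is only bounded by 1, and the
        column weight compensates for \<open>exp (- \<beta> m)\<close>.\<close>
      have "\<beta> m \<le> real M * \<beta> n" using False n m by (intro stab) (simp_all add: m_def)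
      also have "\<dots> \<le> real M * (A * \<alpha> n + B)" using B[OF n] by (intro mult_left_mono) auto
      also have "\<dots> = real M * B + (real M * A) * \<alpha> n" by (simp add: algebra_simps)
      also have "\<dots> \<le> real M * B + real p * \<alpha> n"
        using p \<alpha>0[OF n] by (intro add_left_mono mult_right_mono) auto
      finally have "0 \<le> real M * B + real p * \<alpha> n + - (1 / real 1) * \<beta> m" by simp
      then have "1 \<le> D * ?w p n * ?v 1 m"
        unfolding D_def exp_add[symmetric] by (rule one_le_exp_iff[THEN iffD2])
      moreover have "?v k j \<le> 1" using \<beta>0[OF j] by simp
      ultimately show ?thesis by (smt (verit) exp_gt_zero)
    qed
    from mult_left_mono[OF this norm_ge_zero[of "reindex \<theta> m"]]
    show ?thesis unfolding col G_def m_def[symmetric] by (simp add: algebra_simps)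
  qed
  have G0: "0 \<le> G k n m" for k n m unfolding G_def D_def by simp
  have kM: "1 \<le> k * M" if "1 \<le> k" for k using that M1 by simp
  have sG1: "(\<lambda>m. ?r m * ?v (k * M) m) summable_on {1..}" if "1 \<le> k" for k
    by (rule F.wspace_summable[OF \<theta> kM[OF that]])
  have sG2: "(\<lambda>m. D * ?w p n * (?r m * ?v 1 m)) summable_on {1..}" for n
    by (rule summable_on_cmult_right[OF F.wspace_summable[OF \<theta> order_refl]])
  have sG: "G k n summable_on {1..}" if "1 \<le> k" for k n
    unfolding G_def by (rule summable_on_add[OF sG1[OF that] sG2])
  have infG: "infsum (G k n) {1..} = wnorm ?v (k * M) (reindex \<theta>) + D * ?w p n * wnorm ?v 1 (reindex \<theta>)"
    if "1 \<le> k" for k n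
    unfolding G_def wnorm_def infsum_add[OF sG1[OF that] sG2] infsum_cmult_right' ..
  have inj: "inj_on (\<lambda>j. j + n - 1) {1..}" for n :: nat by (auto simp: inj_on_def)
  have img: "(\<lambda>j. j + n - 1) ` {1..} \<subseteq> {1..}" if "1 \<le> n" for n :: nat using that by auto
  have sG': "(\<lambda>j. G k n (j + n - 1)) summable_on {1..}" if "1 \<le> k" "1 \<le> n" for k n
    using summable_on_subset_banach[OF sG[OF that(1)] img[OF that(2)]]
    unfolding summable_on_reindex[OF inj] o_def .
  have s: "(\<lambda>j. norm (hankel_col \<theta> n j) * ?v k j) summable_on {1..}" if "1 \<le> k" "1 \<le> n" for k n
    by (rule summable_on_comparison_test[OF sG'[OF that]]) (use pointwise that in auto)
  define C where "C k = wnorm ?v (k * M) (reindex \<theta>) + D * wnorm ?v 1 (reindex \<theta>)" for k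
  have "column_bound ?w ?v (hankel_col \<theta>) p C"
  proof unfold_locales
    show "1 \<le> p" using p by simp
    show "hankel_col \<theta> n \<in> wspace ?v" if "1 \<le> n" for n
      using s that by (intro F.wspaceI) (auto simp: hankel_col_def)
    show "wnorm ?v k (hankel_col \<theta> n) \<le> C k * ?w p n" if k: "1 \<le> k" and n: "1 \<le> n" for k n
    proof -
      have "wnorm ?v k (hankel_col \<theta> n) \<le> (\<Sum>\<^sub>\<infinity>j\<in>{1..}. G k n (j + n - 1))"
        unfolding wnorm_def by (rule infsum_mono[OF s[OF k n] sG'[OF k n]]) (use pointwise k n in auto)
      also have "\<dots> = infsum (G k n) ((\<lambda>j. j + n - 1) ` {1..})"
        unfolding infsum_reindex[OF inj] o_def ..
      also have "\<dots> \<le> infsum (G k n) {1..}"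
        using img[OF n] G0
        by (intro infsum_mono_neutral summable_on_subset_banach[OF sG[OF k]] sG k) auto
      \<comment> \<open>The factor 1 is written out to be enlarged to
        \<open>exp (real p * \<alpha> n)\<close>, so that both summands carry the column
        weight.\<close>
      also have "\<dots> = wnorm ?v (k * M) (reindex \<theta>) * 1 + D * ?w p n * wnorm ?v 1 (reindex \<theta>)"
        using infG[OF k] by simp
      also have "\<dots> \<le> wnorm ?v (k * M) (reindex \<theta>) * ?w p n + D * ?w p n * wnorm ?v 1 (reindex \<theta>)"
        using \<alpha>0[OF n] F.wnorm_nonneg[OF kM[OF k]]
        by (intro add_right_mono mult_left_mono) auto
      also have "\<dots> = C k * ?w p n" unfolding C_def by (simp add: algebra_simps)
      finally show ?thesis .
    qed
  qed
  then show thesis by (rule that)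
qed

section \<open>Identification of the Hankel operator with its column sums\<close>

theorem theorem3p11:
  fixes \<alpha> \<beta> :: "nat \<Rightarrow> real" and \<theta> :: "nat \<Rightarrow> 'a::{real_normed_field,banach,heine_borel}"
  assumes "exponent_sequence \<beta>" and "exponent_sequence \<alpha>"
    and "stable_sequence \<beta>"
    and "\<exists>A>0. \<exists>B>0. \<forall>n\<ge>1. \<beta> n \<le> A * \<alpha> n + B"
    and "reindex \<theta> \<in> topspace (Lambda_1 \<beta>)"
  shows "hankel_well_defined (Lambda_inf \<alpha>) (Lambda_1 \<beta>) \<theta>
       \<and> continuous_map (Lambda_inf \<alpha>) (Lambda_1 \<beta>) (hankel (Lambda_1 \<beta>) \<theta>)
       \<and> compact_operator (Lambda_inf \<alpha>) (Lambda_1 \<beta>) (hankel (Lambda_1 \<beta>) \<theta>)"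
proof -
  let ?v = "\<lambda>k n. exp (- (1 / real k) * \<beta> n)" and ?w = "\<lambda>k n. exp (real k * \<alpha> n)"
  obtain p C where bound: "column_bound ?w ?v (hankel_col \<theta>) p C"
    using hankel_column_bound assms unfolding topspace_wtop by blast
  interpret column_bound ?w ?v "hankel_col \<theta>" p C by (rule bound)
  have sums: "hankel_sums_to (Lambda_1 \<beta>) \<theta> x (column_sum (hankel_col \<theta>) x)"
    if "x \<in> wspace ?w" for x
    unfolding hankel_sums_to_def by (rule column_partial_sums_limit[OF that])
  \<comment> \<open>The definite description is resolved by existence and uniqueness of the limit,
    on the domain space only; continuity, linearity and compactness are then transferred from
    \<open>column_sum\<close> there.\<close>
  have hankel_eq: "hankel (Lambda_1 \<beta>) \<theta> x = column_sum (hankel_col \<theta>) x"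
    if "x \<in> wspace ?w" for x
    unfolding hankel_def
  proof (rule the_equality)
    show "y = column_sum (hankel_col \<theta>) x" if "hankel_sums_to (Lambda_1 \<beta>) \<theta> x y" for y
      using F.limitin_wtop_unique[OF _ _ sequentially_bot] that sums[OF \<open>x \<in> wspace ?w\<close>]
      unfolding hankel_sums_to_def by blast
  qed (rule sums[OF that])
  have "hankel_well_defined (Lambda_inf \<alpha>) (Lambda_1 \<beta>) \<theta>"
    unfolding hankel_well_defined_def topspace_wtop using column_in sums by blast
  moreover have "continuous_map (Lambda_inf \<alpha>) (Lambda_1 \<beta>) (hankel (Lambda_1 \<beta>) \<theta>)"
    by (rule continuous_map_eq[OF continuous_map_column_sum]) (simp only: topspace_wtop hankel_eq)
  moreover have "compact_operator (Lambda_inf \<alpha>) (Lambda_1 \<beta>) (hankel (Lambda_1 \<beta>) \<theta>)"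
  proof -
    obtain U where U: "zero_nbhd (Lambda_inf \<alpha>) U"
      and pre: "precompact_in (Lambda_1 \<beta>) (column_sum (hankel_col \<theta>) ` U)"
      using compact_operator_column_sum[OF bound schwartz_weights_1[OF assms(1)]]
      unfolding compact_operator_def by blast
    have "hankel (Lambda_1 \<beta>) \<theta> ` U = column_sum (hankel_col \<theta>) ` U"
      using U hankel_eq unfolding zero_nbhd_def topspace_wtop by (intro image_cong) auto
    with U pre have "\<exists>U. zero_nbhd (Lambda_inf \<alpha>) U \<and> precompact_in (Lambda_1 \<beta>) (hankel (Lambda_1 \<beta>) \<theta> ` U)"
      by metis
    moreover have "linear_map_on (topspace (Lambda_inf \<alpha>)) (hankel (Lambda_1 \<beta>) \<theta>)"
      unfolding linear_map_on_def topspace_wtop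
      by (intro ballI allI) (simp only: hankel_eq E.lincomb_in_wspace column_sum_lincomb)
    ultimately show ?thesis unfolding compact_operator_def by blast
  qed
  ultimately show ?thesis by blast
qed

end
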